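(* Let $\sum_{i=1}^{\infty} a_i$ be an absolutely convergent series of real numbers. Let $I=\{\frac1n : n\in\mathbb{N}\}$ ($\mathbb{N}=\{1,2,\dots\}$) with the usual metric, and let $s:[I]^{<\infty}\to\mathbb{R}$ be defined by $s(H)=\sum_{h\in H} a_{1/h}$. Then for every $c\in\mathbb{R}$: $\sum_{i=1}^{\infty} a_i=c$ if and only if $\mathrm{ext}(s,I)=c$.
   Context: For a set $I$, $[I]^{<\infty}$ is the set of all finite subsets of $I$. For a pseudo-metric space $(I,d)$, $A\subset I$ and $\epsilon>0$, let $S(A,\epsilon)=\bigcup_{x\in A}\{y\in I: d(x,y)<\epsilon\}$. The Hausdorff pseudo-metric on subsets of $I$ is $d_H(A,C)=\inf\{\epsilon>0: A\subset S(C,\epsilon),\ C\subset S(A,\epsilon)\}$ (with $\inf\emptyset=+\infty$). $I$ is totally bounded if for every $\delta>0$ there is a finite $K\subset I$ with $S(K,\delta)=I$. Let $(I,d)$ be a totally bounded pseudo-metric space, $s:[I]^{<\infty}\to\mathbb{R}$ and $A\in\mathbb{R}$. We write $\mathrm{ext}(s,I)=A$ if for every $\epsilon>0$ there is $\delta>0$ such that $K\in[I]^{<\infty}$ and $d_H(K,I)<\delta$ imply $|s(K)-A|<\epsilon$. *)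

theory Defs
  imports "HOL-Analysis.Analysis"
begin

locale pseudometric_space =
  fixes I :: "'a set" and d :: "'a \<Rightarrow> 'a \<Rightarrow> real"
  assumes nonneg: "\<lbrakk>x \<in> I; y \<in> I\<rbrakk> \<Longrightarrow> 0 \<le> d x y"
    and self_zero: "x \<in> I \<Longrightarrow> d x x = 0"
    and commute: "\<lbrakk>x \<in> I; y \<in> I\<rbrakk> \<Longrightarrow> d x y = d y x"
    and triangle: "\<lbrakk>x \<in> I; y \<in> I; z \<in> I\<rbrakk> \<Longrightarrow> d x z \<le> d x y + d y z"
begin

definition nbhd :: "'a set \<Rightarrow> real \<Rightarrow> 'a set" where
  "nbhd A \<epsilon> = (\<Union>x\<in>A. {y \<in> I. d x y < \<epsilon>})"

text \<open>The infimum is taken in the extended reals, so that it is infinite on the empty set.\<close>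

definition hausdorff_pdist :: "'a set \<Rightarrow> 'a set \<Rightarrow> ereal" where
  "hausdorff_pdist A C =
     Inf {ereal \<epsilon> | \<epsilon>. 0 < \<epsilon> \<and> A \<subseteq> nbhd C \<epsilon> \<and> C \<subseteq> nbhd A \<epsilon>}"

end

locale totally_bounded_pseudometric_space = pseudometric_space +
  assumes totally_bounded: "0 < \<delta> \<Longrightarrow> \<exists>K\<subseteq>I. finite K \<and> nbhd K \<delta> = I"
begin

text \<open>\<open>has_ext s A\<close> renders the notation \<open>ext(s, I) = A\<close>. Only the values of \<open>s\<close> on the
  finite subsets of \<open>I\<close> matter.\<close>

definition has_ext :: "('a set \<Rightarrow> real) \<Rightarrow> real \<Rightarrow> bool" where
  "has_ext s A \<longleftrightarrow>
     (\<forall>\<epsilon>>0. \<exists>\<delta>>0. \<forall>K. K \<subseteq> I \<and> finite K \<and> hausdorff_pdist K I < ereal \<delta> \<longrightarrow> \<bar>s K - A\<bar> < \<epsilon>)"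

end

definition unit_fractions :: "real set" where
  "unit_fractions = {1 / real n | n. 1 \<le> n}"

text \<open>For \<open>h = 1 / n\<close> the index \<open>nat \<lfloor>1 / h\<rfloor>\<close> is exactly \<open>n\<close>; the floor only serves to
  convert the real number \<open>1 / h\<close> to a natural number.\<close>

definition partial_sum :: "(nat \<Rightarrow> real) \<Rightarrow> real set \<Rightarrow> real" where
  "partial_sum a H = (\<Sum>h\<in>H. a (nat \<lfloor>1 / h\<rfloor>))"

lemma index_unit_fraction: "nat \<lfloor>1 / (1 / real n)\<rfloor> = n"
  by simp

text \<open>A constant defined inside a locale does not carry the locale assumptions when it is used
  outside; the following shows that they hold for the unit fractions.\<close>

lemma totally_bounded_unit_fractions:
  "totally_bounded_pseudometric_space unit_fractions dist"
proof -
  interpret pseudometric_space unit_fractions dist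
    by unfold_locales (auto simp: dist_commute dist_triangle)
  show ?thesis
  proof unfold_locales
    fix \<delta> :: real
    assume "0 < \<delta>"
    then obtain N :: nat where N: "0 < N" "1 / real N < \<delta>"
      by (metis nat_approx_posE zero_less_Suc)
    define K where "K = (\<lambda>n. 1 / real n) ` {1..N}"
    have "K \<subseteq> unit_fractions" "finite K"
      by (auto simp: K_def unit_fractions_def)
    moreover have "y \<in> nbhd K \<delta>" if y: "y \<in> unit_fractions" for y
    proof -
      obtain n where n: "y = 1 / real n" "1 \<le> n"
        using y by (auto simp: unit_fractions_def)
      have "\<exists>x\<in>K. dist x y < \<delta>"
      proof (cases "n \<le> N")
        case True
        then have "y \<in> K" using n by (auto simp: K_def)
        then show ?thesis using \<open>0 < \<delta>\<close> by (intro bexI[of _ y]) auto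
      next
        case False
        then have "1 / real n \<le> 1 / real N" "0 < 1 / real n"
          using N n by (auto simp: frac_le)
        then have "dist (1 / real N) y < \<delta>"
          unfolding dist_real_def n using N by linarith
        moreover have "1 / real N \<in> K" using N by (auto simp: K_def)
        ultimately show ?thesis by blast
      qed
      then show ?thesis using y by (auto simp: nbhd_def)
    qed
    moreover have "nbhd K \<delta> \<subseteq> unit_fractions"
      by (auto simp: nbhd_def)
    ultimately show "\<exists>K\<subseteq>unit_fractions. finite K \<and> nbhd K \<delta> = unit_fractions"
      by blast
  qed
qed

end

theory Submission
  imports Defs
begin

text \<open>Each point \<open>1 / n\<close> is isolated in the unit fractions, at distance at least
  \<open>1 / (n (n + 1))\<close> from all others. Hence a finite set close to the whole space contains the
  first \<open>N\<close> unit fractions, and unconditional convergence puts its sum close to the sum of the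
  series. Conversely, the series converges to some value, which is then the extension, and
  extensions are unique because totally bounded spaces have arbitrarily close finite subsets.\<close>

context totally_bounded_pseudometric_space
begin

text \<open>An infimum below \<delta> is undercut by some admissible radius \<epsilon> < \<delta>,
  and the covering of \<open>C\<close> at that radius supplies the point.\<close>

lemma hausdorff_pdist_less_imp_nbhd:
  assumes "hausdorff_pdist A C < ereal \<delta>" and "x \<in> C"
  shows "\<exists>y\<in>A. d y x < \<delta>"
proof -
  obtain \<epsilon> where \<epsilon>: "\<epsilon> < \<delta>" "C \<subseteq> nbhd A \<epsilon>"
    using assms(1) unfolding hausdorff_pdist_def by (auto simp: Inf_less_iff)
  then obtain y where "y \<in> A" "d y x < \<epsilon>"
    using assms(2) unfolding nbhd_def by blast
  with \<epsilon> show ?thesis by force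
qed

lemma finite_hausdorff_dense:
  assumes "0 < \<delta>"
  shows "\<exists>K\<subseteq>I. finite K \<and> hausdorff_pdist K I < ereal \<delta>"
proof -
  \<comment> \<open>Radius \<delta> / 2 is admissible in the infimum, which is therefore at most
    \<delta> / 2 and strictly below \<delta>.\<close>
  obtain K where K: "K \<subseteq> I" "finite K" "nbhd K (\<delta> / 2) = I"
    using totally_bounded[of "\<delta> / 2"] assms by auto
  have "K \<subseteq> nbhd I (\<delta> / 2)"
    using K(1) assms by (force simp: nbhd_def self_zero)
  with K assms have "hausdorff_pdist K I \<le> ereal (\<delta> / 2)"
    unfolding hausdorff_pdist_def
    by (intro Inf_lower CollectI exI[of _ "\<delta> / 2"]) auto
  also have "\<dots> < ereal \<delta>"
    using assms by simp
  finally show ?thesis using K by blast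
qed

lemma has_ext_unique:
  assumes "has_ext s A" and "has_ext s B"
  shows "A = B"
proof (rule ccontr)
  assume "A \<noteq> B"
  \<comment> \<open>With half the gap, two strict bounds by \<epsilon> add up to less than the gap
    itself, against the triangle inequality.\<close>
  define \<epsilon> where "\<epsilon> = \<bar>A - B\<bar> / 2"
  have "0 < \<epsilon>" using \<open>A \<noteq> B\<close> by (simp add: \<epsilon>_def)
  obtain \<delta>1 where \<delta>1: "0 < \<delta>1"
    "\<And>K. K \<subseteq> I \<Longrightarrow> finite K \<Longrightarrow> hausdorff_pdist K I < ereal \<delta>1 \<Longrightarrow> \<bar>s K - A\<bar> < \<epsilon>"
    using assms(1) \<open>0 < \<epsilon>\<close> unfolding has_ext_def by meson
  obtain \<delta>2 where \<delta>2: "0 < \<delta>2"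
    "\<And>K. K \<subseteq> I \<Longrightarrow> finite K \<Longrightarrow> hausdorff_pdist K I < ereal \<delta>2 \<Longrightarrow> \<bar>s K - B\<bar> < \<epsilon>"
    using assms(2) \<open>0 < \<epsilon>\<close> unfolding has_ext_def by meson
  obtain K where K: "K \<subseteq> I" "finite K" "hausdorff_pdist K I < ereal (min \<delta>1 \<delta>2)"
    using finite_hausdorff_dense[of "min \<delta>1 \<delta>2"] \<delta>1(1) \<delta>2(1) by auto
  have "hausdorff_pdist K I < ereal \<delta>1" "hausdorff_pdist K I < ereal \<delta>2"
    using less_le_trans[OF K(3)] by auto
  then have "\<bar>s K - A\<bar> < \<epsilon>" "\<bar>s K - B\<bar> < \<epsilon>"
    using K \<delta>1(2) \<delta>2(2) by auto
  moreover have "\<bar>A - B\<bar> \<le> \<bar>s K - A\<bar> + \<bar>s K - B\<bar>" by linarith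
  ultimately show False by (simp add: \<epsilon>_def)
qed

end

text \<open>The bound is the gap between \<open>1 / n\<close> and \<open>1 / (n + 1)\<close>, its
  nearest neighbour; the gap on the other side is larger.\<close>

lemma unit_fraction_isolated:
  assumes "1 \<le> m" "1 \<le> n" "\<bar>1 / real m - 1 / real n\<bar> < 1 / (real n * (real n + 1))"
  shows "m = n"
proof (rule ccontr)
  assume "m \<noteq> n"
  then have "1 \<le> \<bar>real n - real m\<bar>" by linarith
  have eq: "\<bar>1 / real m - 1 / real n\<bar> = \<bar>real n - real m\<bar> / (real m * real n)"
    using assms(1,2) by (simp add: field_simps abs_divide abs_mult)
  \<comment> \<open>Clearing denominators in the negated bound and cancelling \<open>n\<close>
    leaves exactly this inequality.\<close>
  have "real m \<le> \<bar>real n - real m\<bar> * (real n + 1)"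
  proof (cases "m \<le> n")
    case True
    then have "real m \<le> 1 * (real n + 1)" by simp
    also have "\<dots> \<le> \<bar>real n - real m\<bar> * (real n + 1)"
      using \<open>1 \<le> \<bar>real n - real m\<bar>\<close> by (intro mult_right_mono) auto
    finally show ?thesis .
  next
    case False
    \<comment> \<open>For \<open>m > n\<close> the right-hand side is
      \<open>n * (m - n) + (m - n)\<close>, which is at least
      \<open>n + (m - n) = m\<close>.\<close>
    have "real n * 1 \<le> real n * (real m - real n)"
      using False by (intro mult_left_mono) auto
    with False show ?thesis by (simp add: algebra_simps)
  qed
  then have "real m * real n * 1 \<le> \<bar>real n - real m\<bar> * (real n * (real n + 1))"
    using mult_left_mono[of "real m" "\<bar>real n - real m\<bar> * (real n + 1)" "real n"]
    by (simp add: mult_ac)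
  then have "1 / (real n * (real n + 1)) \<le> \<bar>real n - real m\<bar> / (real m * real n)"
    using assms(1,2) by (simp add: pos_divide_le_eq pos_le_divide_eq mult_ac)
  with assms(3) eq show False by linarith
qed

text \<open>The bijection between \<open>1 / (i + 1)\<close> and \<open>i\<close> turns a sum over
  points into a sum over indices, the form in which \<open>has_sum\<close> applies. The shift by one
  matches a series that starts at \<open>a 1\<close>.\<close>

lemma partial_sum_eq_sum:
  assumes "K \<subseteq> unit_fractions"
  shows "partial_sum a K = (\<Sum>i | 1 / real (Suc i) \<in> K. a (Suc i))"
  unfolding partial_sum_def
proof (rule sum.reindex_bij_witness
    [of _ "\<lambda>i. 1 / real (Suc i)" "\<lambda>h. nat \<lfloor>1 / h\<rfloor> - 1"])
  fix h assume "h \<in> K"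
  then obtain n where n: "h = 1 / real n" "1 \<le> n"
    using assms by (auto simp: unit_fractions_def)
  then have idx: "nat \<lfloor>1 / h\<rfloor> = n" by (simp only: index_unit_fraction)
  show "1 / real (Suc (nat \<lfloor>1 / h\<rfloor> - 1)) = h"
    unfolding idx using n by simp
  then show "nat \<lfloor>1 / h\<rfloor> - 1 \<in> {i. 1 / real (Suc i) \<in> K}"
    using \<open>h \<in> K\<close> by simp
  show "a (Suc (nat \<lfloor>1 / h\<rfloor> - 1)) = a (nat \<lfloor>1 / h\<rfloor>)"
    unfolding idx using n by simp
next
  fix i
  show "nat \<lfloor>1 / (1 / real (Suc i))\<rfloor> - 1 = i"
    by (simp only: index_unit_fraction diff_Suc_1)
qed simp

lemma finite_unit_fraction_indices:
  assumes "finite K"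
  shows "finite {i. 1 / real (Suc i) \<in> K}"
  using finite_vimageI[OF assms, of "\<lambda>i. 1 / real (Suc i)"]
  by (simp add: vimage_def inj_def)

lemma sums_imp_has_ext:
  fixes a :: "nat \<Rightarrow> real"
  assumes "summable (\<lambda>i. \<bar>a (Suc i)\<bar>)" and "(\<lambda>i. a (Suc i)) sums c"
  shows "totally_bounded_pseudometric_space.has_ext unit_fractions dist (partial_sum a) c"
proof -
  interpret totally_bounded_pseudometric_space unit_fractions dist
    by (rule totally_bounded_unit_fractions)
  \<comment> \<open>Absolute convergence upgrades the limit of initial segments to a limit along all
    finite index sets.\<close>
  have has_sum: "((\<lambda>i. a (Suc i)) has_sum c) UNIV"
    using assms by (intro norm_summable_imp_has_sum) auto
  show ?thesis unfolding has_ext_def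
  proof (intro allI impI)
    fix \<epsilon> :: real assume "0 < \<epsilon>"
    then obtain X where X: "finite X"
      "\<And>Y. finite Y \<Longrightarrow> X \<subseteq> Y \<Longrightarrow> dist (\<Sum>i\<in>Y. a (Suc i)) c < \<epsilon>"
      using tendstoD[OF has_sum[unfolded has_sum_def]]
      unfolding eventually_finite_subsets_at_top by (metis subset_UNIV)
    obtain N where N: "\<And>i. i \<in> X \<Longrightarrow> i < N"
      using X(1) finite_nat_set_iff_bounded by auto
    \<comment> \<open>This is the isolation gap of \<open>1 / (N + 1)\<close>. Gaps shrink as the
      index grows, so it serves for every index in \<open>X\<close>.\<close>
    define \<delta> where "\<delta> = 1 / (real (Suc N) * (real (Suc N) + 1))"
    have "\<bar>partial_sum a K - c\<bar> < \<epsilon>"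
      if K: "K \<subseteq> unit_fractions" "finite K"
        "hausdorff_pdist K unit_fractions < ereal \<delta>" for K
    proof -
      have "1 / real (Suc i) \<in> K" if "i \<in> X" for i
      proof -
        have "1 / real (Suc i) \<in> unit_fractions"
          unfolding unit_fractions_def by fastforce
        then obtain y where y: "y \<in> K" "dist y (1 / real (Suc i)) < \<delta>"
          using hausdorff_pdist_less_imp_nbhd[OF K(3)] by blast
        then obtain m where m: "y = 1 / real m" "1 \<le> m"
          using K(1) by (auto simp: unit_fractions_def)
        have "\<delta> \<le> 1 / (real (Suc i) * (real (Suc i) + 1))"
          unfolding \<delta>_def using N[OF that] by (intro divide_left_mono mult_mono) auto
        then have "m = Suc i"
          using y(2) m by (intro unit_fraction_isolated) (auto simp: dist_real_def)
        then show ?thesis using y m by simp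
      qed
      then have "dist (\<Sum>i | 1 / real (Suc i) \<in> K. a (Suc i)) c < \<epsilon>"
        using finite_unit_fraction_indices[OF K(2)] by (intro X(2)) auto
      then show ?thesis
        by (simp only: partial_sum_eq_sum[OF K(1)] dist_real_def)
    qed
    moreover have "0 < \<delta>" by (simp add: \<delta>_def)
    ultimately show "\<exists>\<delta>>0. \<forall>K. K \<subseteq> unit_fractions \<and> finite K \<and>
        hausdorff_pdist K unit_fractions < ereal \<delta> \<longrightarrow> \<bar>partial_sum a K - c\<bar> < \<epsilon>"
      by blast
  qed
qed

theorem theorem4p8:
  fixes a :: "nat \<Rightarrow> real" and c :: real
  assumes "summable (\<lambda>i. \<bar>a (Suc i)\<bar>)"
  shows "(\<lambda>i. a (Suc i)) sums c \<longleftrightarrow>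
    totally_bounded_pseudometric_space.has_ext unit_fractions dist (partial_sum a) c"
proof
  assume "(\<lambda>i. a (Suc i)) sums c"
  with assms show "totally_bounded_pseudometric_space.has_ext unit_fractions dist (partial_sum a) c"
    by (rule sums_imp_has_ext)
next
  assume ext: "totally_bounded_pseudometric_space.has_ext unit_fractions dist (partial_sum a) c"
  \<comment> \<open>Absolute convergence ensures that the infinite sum is a genuine limit, so the
    forward direction makes it an extension too.\<close>
  have sums: "(\<lambda>i. a (Suc i)) sums (\<Sum>i. a (Suc i))"
    using summable_rabs_cancel[OF assms] by (rule summable_sums)
  have "(\<Sum>i. a (Suc i)) = c"
    using totally_bounded_pseudometric_space.has_ext_unique
      [OF totally_bounded_unit_fractions sums_imp_has_ext[OF assms sums] ext] .
  with sums show "(\<lambda>i. a (Suc i)) sums c" by simp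
qed

end
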